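(* Let $\mathcal U=\{U_\alpha\}_{\alpha\in A}$ be an open cover of a non-Hausdorff manifold $\mathbf{M}$. If each $U_\alpha$ is Hausdorff, then the cover $\mathcal U$ does not admit a partition of unity subordinate to it.
   Context: A non-Hausdorff manifold is a locally Euclidean, second-countable, connected topological space that is not Hausdorff. A partition of unity subordinate to $\{U_\alpha\}$ is a family of continuous functions $\psi_\alpha:\mathbf{M}\to[0,1]$ such that the closure in $\mathbf{M}$ of $\{x : \psi_\alpha(x)\neq0\}$ is contained in $U_\alpha$ for each $\alpha$, the family of these closures is locally finite, and $\sum_\alpha\psi_\alpha(x)=1$ for all $x\in\mathbf{M}$. *)

theory Defs
  imports "HOL-Analysis.Analysis"
begin

text \<open>One dimension \<open>n\<close> serves all points. For connected spaces this is no restriction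
  compared with a pointwise dimension, by invariance of dimension.\<close>

definition locally_Euclidean_space :: "'a topology \<Rightarrow> bool" where
  "locally_Euclidean_space X \<longleftrightarrow>
     (\<exists>n. \<forall>x\<in>topspace X. \<exists>U V. openin X U \<and> x \<in> U \<and> openin (Euclidean_space n) V \<and>
        subtopology X U homeomorphic_space subtopology (Euclidean_space n) V)"

definition non_Hausdorff_manifold :: "'a topology \<Rightarrow> bool" where
  "non_Hausdorff_manifold X \<longleftrightarrow>
     locally_Euclidean_space X \<and> second_countable X \<and> connected_space X \<and>
     \<not> Hausdorff_space X"

definition supp_in :: "'a topology \<Rightarrow> ('a \<Rightarrow> real) \<Rightarrow> 'a set" where
  "supp_in X f = X closure_of {x \<in> topspace X. f x \<noteq> 0}"

text \<open>Local finiteness of an indexed family counts indices, whereas \<^const>\<open>locally_finite_in\<close>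
  counts distinct members of a set of sets.\<close>

definition locally_finite_family :: "'a topology \<Rightarrow> 'i set \<Rightarrow> ('i \<Rightarrow> 'a set) \<Rightarrow> bool" where
  "locally_finite_family X A S \<longleftrightarrow>
     (\<forall>x\<in>topspace X. \<exists>V. openin X V \<and> x \<in> V \<and> finite {\<alpha> \<in> A. S \<alpha> \<inter> V \<noteq> {}})"

definition partition_of_unity_subordinate ::
    "'a topology \<Rightarrow> 'i set \<Rightarrow> ('i \<Rightarrow> 'a set) \<Rightarrow> ('i \<Rightarrow> 'a \<Rightarrow> real) \<Rightarrow> bool" where
  "partition_of_unity_subordinate X A U \<psi> \<longleftrightarrow>
     (\<forall>\<alpha>\<in>A. continuous_map X (top_of_set {0..1}) (\<psi> \<alpha>)) \<and>
     (\<forall>\<alpha>\<in>A. supp_in X (\<psi> \<alpha>) \<subseteq> U \<alpha>) \<and>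
     locally_finite_family X A (\<lambda>\<alpha>. supp_in X (\<psi> \<alpha>)) \<and>
     (\<forall>x\<in>topspace X. ((\<lambda>\<alpha>. \<psi> \<alpha> x) has_sum 1) A)"

end

theory Submission
  imports Defs
begin

text \<open>A partition of unity subordinate to a cover by open Hausdorff sets forces the whole
  space to be Hausdorff. Given distinct points x and y, some \<psi>_\<alpha> is nonzero at x. If it
  takes different values at x and y, it separates them by continuity. If the values agree, both are
  nonzero, so x and y lie together in U_\<alpha>, where they can be separated.\<close>

lemma Hausdorff_space_if_partition_of_unity:
  assumes pu: "partition_of_unity_subordinate X A U \<psi>"
    and op: "\<And>\<alpha>. \<alpha> \<in> A \<Longrightarrow> openin X (U \<alpha>)"
    and haus: "\<And>\<alpha>. \<alpha> \<in> A \<Longrightarrow> Hausdorff_space (subtopology X (U \<alpha>))"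
  shows "Hausdorff_space X"
  unfolding Hausdorff_space_def
proof (intro allI impI, elim conjE)
  fix x y assume x: "x \<in> topspace X" and y: "y \<in> topspace X" and "x \<noteq> y"
  have "((\<lambda>\<alpha>. \<psi> \<alpha> x) has_sum 1) A"
    using pu x unfolding partition_of_unity_subordinate_def by blast
  \<comment> \<open>If every \<open>\<psi> \<alpha> x\<close> with \<open>\<alpha> \<in> A\<close>
    vanished, the sum would also be 0, against uniqueness of sums.\<close>
  then obtain \<alpha> where \<alpha>: "\<alpha> \<in> A" "\<psi> \<alpha> x \<noteq> 0"
    by (metis has_sum_0 has_sum_unique zero_neq_one)
  have cont: "continuous_map X euclideanreal (\<psi> \<alpha>)"
    using pu \<alpha>(1)
    by (auto simp: partition_of_unity_subordinate_def continuous_map_in_subtopology)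
  show "\<exists>V W. openin X V \<and> openin X W \<and> x \<in> V \<and> y \<in> W \<and> disjnt V W"
  proof (cases "\<psi> \<alpha> x = \<psi> \<alpha> y")
    case True
    \<comment> \<open>The nonvanishing set lies in its closure, the support, hence in
      \<open>U \<alpha>\<close>; the common nonzero value puts both points there.\<close>
    have "{z \<in> topspace X. \<psi> \<alpha> z \<noteq> 0} \<subseteq> U \<alpha>"
      using pu \<alpha>(1) closure_of_subset[of "{z \<in> topspace X. \<psi> \<alpha> z \<noteq> 0}" X]
      by (auto simp: partition_of_unity_subordinate_def supp_in_def)
    then have "x \<in> U \<alpha>" "y \<in> U \<alpha>"
      using True \<alpha>(2) x y by auto
    then obtain V W where "openin (subtopology X (U \<alpha>)) V" "openin (subtopology X (U \<alpha>)) W"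
      "x \<in> V" "y \<in> W" "disjnt V W"
      using haus[OF \<alpha>(1)] x y \<open>x \<noteq> y\<close>
      unfolding Hausdorff_space_def topspace_subtopology by (metis IntI)
    \<comment> \<open>Sets open in the open subspace \<open>U \<alpha>\<close> are open in
      \<open>X\<close>, so the local separation is a global one.\<close>
    then show ?thesis
      using op[OF \<alpha>(1)] by (auto simp: openin_open_subtopology)
  next
    case False
    \<comment> \<open>The real line is Hausdorff; preimages of disjoint neighbourhoods of the two
      values separate x and y.\<close>
    then obtain P Q where PQ: "open P" "open Q" "\<psi> \<alpha> x \<in> P" "\<psi> \<alpha> y \<in> Q" "P \<inter> Q = {}"
      by (meson hausdorff)
    have "openin X {z \<in> topspace X. \<psi> \<alpha> z \<in> P}" "openin X {z \<in> topspace X. \<psi> \<alpha> z \<in> Q}"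
      using PQ cont by (auto intro: openin_continuous_map_preimage)
    moreover have "disjnt {z \<in> topspace X. \<psi> \<alpha> z \<in> P} {z \<in> topspace X. \<psi> \<alpha> z \<in> Q}"
      using PQ(5) by (auto simp: disjnt_def)
    ultimately show ?thesis
      using PQ(3,4) x y by blast
  qed
qed

theorem theorem2p6:
  fixes M :: "'a topology" and A :: "'i set" and U :: "'i \<Rightarrow> 'a set"
  assumes "non_Hausdorff_manifold M"
    and "\<And>\<alpha>. \<alpha> \<in> A \<Longrightarrow> openin M (U \<alpha>)"
    and "(\<Union>\<alpha>\<in>A. U \<alpha>) = topspace M"
    and "\<And>\<alpha>. \<alpha> \<in> A \<Longrightarrow> Hausdorff_space (subtopology M (U \<alpha>))"
  shows "\<not> (\<exists>\<psi>. partition_of_unity_subordinate M A U \<psi>)"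
  \<comment> \<open>A partition of unity would make \<open>M\<close> Hausdorff, which
    \<open>non_Hausdorff_manifold\<close> excludes.\<close>
  using assms(1) Hausdorff_space_if_partition_of_unity[of M A U, OF _ assms(2) assms(4)]
  unfolding non_Hausdorff_manifold_def by blast

end
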